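(* Let $R((p_n),(q_n))$ and $R((p_n'),(q_n'))$ be a pair of isotropic trees such that the sequence $(p_n')$ is constant. If the integer sequence $\mathcal{X}((p_n),(q_n),(p_n'),(q_n'))$ is unbounded, then there does not exist a rough isometric embedding $R((p_n),(q_n))\to R((p_n'),(q_n'))$.
   Context: Isotropic trees. Let $(p_n)_{n\ge1}$ be a bounded sequence of integers $p_n\ge2$ and $(q_n)_{n\ge1}$ a bounded sequence of reals $q_n>1$ with $\inf_n q_n>1$. The isotropic tree $R((p_n),(q_n))$ is the infinite rooted metric tree constructed as follows: the basepoint $b$ has $p_1$ edges of length $\log(q_1)$ emanating from it; the terminal vertex of each of these has $p_2$ edges of length $\log(q_2)$ emanating from it; the terminal vertex of each of those has $p_3$ edges of length $\log(q_3)$ emanating from it; and so on. The sequences $(p_n'),(q_n')$ satisfy the same standing assumptions. The sequence $\mathcal{X}$. Write $R=R((p_n),(q_n))$, $R'=R((p_n'),(q_n'))$ and set $q_0=q_0'=1$. Let $\mathcal{H}(R)=\{\sum_{i=0}^a\log(q_i):a\in\mathbb{Z}_{\ge0}\}$ and $\mathcal{H}(R')=\{\sum_{i=0}^b\log(q_i'):b\in\mathbb{Z}_{\ge0}\}$, and enumerate $\mathcal{H}(R)\cup\mathcal{H}(R')=\{h_0<h_1<h_2<\cdots\}$. The sequence $\mathcal{X}=\mathcal{X}((p_n),(q_n),(p_n'),(q_n'))$ is defined by $\mathcal{X}_0=1$ and - $\mathcal{X}_{n+1}=p_{a+1}\mathcal{X}_n$ if $h_n=\sum_{i=0}^a\log(q_i)\in\mathcal{H}(R)\setminus\mathcal{H}(R')$;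 - $\mathcal{X}_{n+1}=\lceil \mathcal{X}_n/p_{b+1}'\rceil$ if $h_n=\sum_{i=0}^b\log(q_i')\in\mathcal{H}(R')\setminus\mathcal{H}(R)$; - $\mathcal{X}_{n+1}=\lceil p_{a+1}\mathcal{X}_n/p_{b+1}'\rceil$ if $h_n=\sum_{i=0}^a\log(q_i)=\sum_{i=0}^b\log(q_i')\in\mathcal{H}(R)\cap\mathcal{H}(R')$. A rough isometric embedding $f:X\to Y$ of metric spaces is a map for which there is $C\ge0$ with $|d(f(x),f(x'))-d(x,x')|\le C$ for all $x,x'\in X$. *)

theory Defs
  imports "HOL-Analysis.Analysis" "HOL-Library.Sublist"
begin

section \<open>Isotropic trees\<close>

text \<open>The sequences $(p_n)$ and $(q_n)$ are indexed by $n \ge 1$; the values at index \<open>0\<close> are never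
  used.\<close>

definition isotropic_params :: "(nat \<Rightarrow> nat) \<Rightarrow> (nat \<Rightarrow> real) \<Rightarrow> bool" where
  "isotropic_params p q \<longleftrightarrow>
     (\<forall>n\<ge>1. p n \<ge> 2) \<and> bdd_above (p ` {1..}) \<and>
     (\<forall>n\<ge>1. q n > 1) \<and> bounded (q ` {1..}) \<and> (INF n\<in>{1..}. q n) > 1"

text \<open>The height of the vertices at combinatorial depth \<open>a\<close>. Starting the sum at \<open>1\<close> amounts to the
  convention $q_0 = 1$, that is $\log q_0 = 0$.\<close>

definition level :: "(nat \<Rightarrow> real) \<Rightarrow> nat \<Rightarrow> real" where
  "level q a = (\<Sum>i=1..a. ln (q i))"

text \<open>A vertex at depth \<open>n\<close> is the list \<open>w\<close> of the \<open>n\<close> choices of outgoing edges leading to it from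
  the root, where \<open>w ! i < p (i + 1)\<close>. A non-empty \<open>w\<close> also names the edge ending at that vertex.
  The pair \<open>(w, t)\<close> with \<open>0 < t \<le> ln (q (length w))\<close> is the point of that edge at distance \<open>t\<close>
  from its upper endpoint; the upper endpoint itself belongs to the previous edge, or is the root
  \<open>([], 0)\<close>, so that every point of the tree is represented exactly once.\<close>

definition isotropic_tree :: "(nat \<Rightarrow> nat) \<Rightarrow> (nat \<Rightarrow> real) \<Rightarrow> (nat list \<times> real) set" where
  "isotropic_tree p q =
     insert ([], 0)
       {(w, t). w \<noteq> [] \<and> (\<forall>i<length w. w ! i < p (Suc i)) \<and> 0 < t \<and> t \<le> ln (q (length w))}"

definition height :: "(nat \<Rightarrow> real) \<Rightarrow> nat list \<times> real \<Rightarrow> real" where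
  "height q x = level q (length (fst x) - 1) + snd x"

text \<open>The height of the point at which the segments from the root to \<open>x\<close> and to \<open>y\<close> separate: the
  common vertex of largest depth, unless \<open>x\<close> and \<open>y\<close> lie on a common descending segment.\<close>

definition branch_height :: "(nat \<Rightarrow> real) \<Rightarrow> nat list \<times> real \<Rightarrow> nat list \<times> real \<Rightarrow> real" where
  "branch_height q x y =
     min (min (height q x) (height q y)) (level q (length (longest_common_prefix (fst x) (fst y))))"

text \<open>The path metric: the unique geodesic from \<open>x\<close> to \<open>y\<close> goes from \<open>x\<close> up to the branch point and
  from there down to \<open>y\<close>.\<close>

definition tree_dist :: "(nat \<Rightarrow> real) \<Rightarrow> nat list \<times> real \<Rightarrow> nat list \<times> real \<Rightarrow> real" where
  "tree_dist q x y =
     (height q x - branch_height q x y) + (height q y - branch_height q x y)"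

section \<open>Rough isometric embeddings\<close>

definition rough_isometric_embedding ::
    "'a set \<Rightarrow> ('a \<Rightarrow> 'a \<Rightarrow> real) \<Rightarrow> 'b set \<Rightarrow> ('b \<Rightarrow> 'b \<Rightarrow> real) \<Rightarrow> ('a \<Rightarrow> 'b) \<Rightarrow> bool" where
  "rough_isometric_embedding X dX Y dY f \<longleftrightarrow>
     f \<in> X \<rightarrow> Y \<and> (\<exists>C\<ge>0. \<forall>x\<in>X. \<forall>x'\<in>X. \<bar>dY (f x) (f x') - dX x x'\<bar> \<le> C)"

section \<open>The comparison sequence\<close>

definition heights :: "(nat \<Rightarrow> real) \<Rightarrow> real set" where
  "heights q = range (level q)"

definition height_enum :: "(nat \<Rightarrow> real) \<Rightarrow> (nat \<Rightarrow> real) \<Rightarrow> nat \<Rightarrow> real" where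
  "height_enum q q' = (THE h. strict_mono h \<and> range h = heights q \<union> heights q')"

definition depth_of :: "(nat \<Rightarrow> real) \<Rightarrow> real \<Rightarrow> nat" where
  "depth_of q h = (THE a. h = level q a)"

primrec comparison_seq ::
    "(nat \<Rightarrow> nat) \<Rightarrow> (nat \<Rightarrow> real) \<Rightarrow> (nat \<Rightarrow> nat) \<Rightarrow> (nat \<Rightarrow> real) \<Rightarrow> nat \<Rightarrow> int" where
  "comparison_seq p q p' q' 0 = 1"
| "comparison_seq p q p' q' (Suc n) =
     (let h = height_enum q q' n;
          x = comparison_seq p q p' q' n;
          a = depth_of q h;
          b = depth_of q' h
      in if h \<in> heights q - heights q' then int (p (Suc a)) * x
         else if h \<in> heights q' - heights q then \<lceil>real_of_int x / real (p' (Suc b))\<rceil>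
         else \<lceil>real_of_int (int (p (Suc a)) * x) / real (p' (Suc b))\<rceil>)"

section \<open>Well-definedness\<close>

lemma level_0 [simp]: "level q 0 = 0"
  by (simp add: level_def)

lemma level_Suc: "level q (Suc a) = level q a + ln (q (Suc a))"
  by (simp add: level_def)

lemma strict_mono_level:
  assumes "isotropic_params p q"
  shows "strict_mono (level q)"
proof -
  have "q (Suc n) > 1" for n
    using assms by (simp add: isotropic_params_def)
  then show ?thesis by (simp add: strict_mono_Suc_iff level_Suc ln_gt_zero)
qed

lemma depth_of_level:
  assumes "isotropic_params p q"
  shows "depth_of q (level q a) = a"
  using strict_mono_eq[OF strict_mono_level[OF assms]] by (auto simp: depth_of_def)

lemma lcp_commute: "longest_common_prefix u v = longest_common_prefix v u"
  by (induction u v rule: longest_common_prefix.induct) auto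

lemma length_lcp_triangle:
  "min (length (longest_common_prefix u v)) (length (longest_common_prefix v w))
     \<le> length (longest_common_prefix u w)"
proof -
  let ?a = "longest_common_prefix u v" and ?b = "longest_common_prefix v w"
  consider "prefix ?a ?b" | "prefix ?b ?a"
    using longest_common_prefix_prefix2[of u v] longest_common_prefix_prefix1[of v w]
      prefix_same_cases by blast
  then show ?thesis
  proof cases
    case 1
    then have "prefix ?a w"
      using longest_common_prefix_prefix2 prefix_order.order_trans by blast
    then have "prefix ?a (longest_common_prefix u w)"
      by (simp add: longest_common_prefix_max_prefix longest_common_prefix_prefix1)
    from prefix_length_le[OF this] show ?thesis by simp
  next
    case 2
    then have "prefix ?b u"
      using longest_common_prefix_prefix1 prefix_order.order_trans by blast
    then have "prefix ?b (longest_common_prefix u w)"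
      by (simp add: longest_common_prefix_max_prefix longest_common_prefix_prefix2)
    from prefix_length_le[OF this] show ?thesis by simp
  qed
qed

lemma branch_height_triangle:
  assumes "isotropic_params p q"
  shows "min (branch_height q x y) (branch_height q y z) \<le> branch_height q x z"
proof -
  let ?l = "\<lambda>x y. length (longest_common_prefix (fst x) (fst y))"
  have "mono (level q)"
    using strict_mono_level[OF assms] by (rule strict_mono_mono)
  then have "level q (min (?l x y) (?l y z)) \<le> level q (?l x z)"
    by (rule monoD) (rule length_lcp_triangle)
  then show ?thesis
    unfolding branch_height_def by (auto simp: min_def split: if_splits)
qed

lemma height_less_imp_length:
  assumes "isotropic_params p q" "x \<in> isotropic_tree p q" "height q x \<le> level q k"
  shows "length (fst x) \<le> k"
proof (cases "fst x = []")
  case False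
  with assms(2) have "level q (length (fst x) - 1) < height q x"
    by (auto simp: isotropic_tree_def height_def)
  with assms(3) have "level q (length (fst x) - 1) < level q k"
    by linarith
  then have "length (fst x) - 1 < k"
    using strict_mono_less[OF strict_mono_level[OF assms(1)]] by blast
  then show ?thesis by simp
qed simp

lemma Metric_space_isotropic_tree:
  assumes "isotropic_params p q"
  shows "Metric_space (isotropic_tree p q) (tree_dist q)"
proof
  fix x y
  show "0 \<le> tree_dist q x y"
    by (simp add: tree_dist_def branch_height_def)
  show "tree_dist q x y = tree_dist q y x"
    using lcp_commute[of "fst x" "fst y"] by (simp add: tree_dist_def branch_height_def min.commute)
next
  fix x y z
  show "tree_dist q x z \<le> tree_dist q x y + tree_dist q y z"
  proof -
    have "branch_height q x y \<le> height q y" "branch_height q y z \<le> height q y"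
      by (auto simp: branch_height_def)
    with branch_height_triangle[OF assms, of x y z] show ?thesis
      unfolding tree_dist_def by linarith
  qed
next
  fix x y
  assume x: "x \<in> isotropic_tree p q" and y: "y \<in> isotropic_tree p q"
  let ?c = "longest_common_prefix (fst x) (fst y)"
  show "tree_dist q x y = 0 \<longleftrightarrow> x = y"
  proof
    assume "tree_dist q x y = 0"
    moreover have "branch_height q x y \<le> height q x" "branch_height q x y \<le> height q y"
        "branch_height q x y \<le> level q (length ?c)"
      by (auto simp: branch_height_def)
    ultimately have h: "height q x = height q y" "height q x \<le> level q (length ?c)"
        "height q y \<le> level q (length ?c)"
      unfolding tree_dist_def by linarith+
    have "length (fst x) \<le> length ?c" "length (fst y) \<le> length ?c"
      using height_less_imp_length[OF assms x h(2)] height_less_imp_length[OF assms y h(3)] .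
    then have "?c = fst x" "?c = fst y"
      using longest_common_prefix_prefix1[of "fst x" "fst y"]
        longest_common_prefix_prefix2[of "fst x" "fst y"]
      by (metis prefix_def append_Nil2 length_append le_add_same_cancel1 length_0_conv le_zero_eq
            add_le_same_cancel1)+
    then have "fst x = fst y" by simp
    moreover from this h(1) have "snd x = snd y" by (simp add: height_def)
    ultimately show "x = y" by (simp add: prod_eq_iff)
  next
    assume [simp]: "x = y"
    have "longest_common_prefix w w = w" for w :: "nat list"
      by (induction w) auto
    moreover have "height q y \<le> level q (length (fst y))"
    proof (cases "length (fst y)")
      case (Suc n)
      then show ?thesis using y
        by (auto simp: isotropic_tree_def height_def level_Suc)
    qed (use y in \<open>auto simp: isotropic_tree_def height_def\<close>)
    ultimately show "tree_dist q x y = 0"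
      by (simp add: tree_dist_def branch_height_def)
  qed
qed

lemma level_ge_linear:
  assumes "isotropic_params p q"
  obtains c where "c > 0" "\<And>a. real a * c \<le> level q a"
proof
  let ?m = "INF n\<in>{1..}. q n"
  have m: "?m > 1" using assms by (simp add: isotropic_params_def)
  then show "ln ?m > 0" by simp
  have "bdd_below (q ` {1..})"
    using assms by (simp add: isotropic_params_def bounded_imp_bdd_below)
  then have le: "?m \<le> q n" if "n \<ge> 1" for n
    using that by (auto intro: cINF_lower)
  have step: "ln ?m \<le> ln (q (Suc a))" for a
    using le[of "Suc a"] m by simp
  show "real a * ln ?m \<le> level q a" for a
  proof (induction a)
    case (Suc a)
    then show ?case using step[of a] by (simp add: level_Suc algebra_simps)
  qed simp
qed

lemma finite_heights_le:
  assumes "isotropic_params p q"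
  shows "finite {h \<in> heights q. h \<le> B}"
proof -
  obtain c where c: "c > 0" "\<And>a. real a * c \<le> level q a"
    using level_ge_linear[OF assms] by blast
  have "{h \<in> heights q. h \<le> B} \<subseteq> level q ` {a. real a \<le> B / c}"
  proof
    fix h assume "h \<in> {h \<in> heights q. h \<le> B}"
    then obtain a where a: "h = level q a" "level q a \<le> B" by (auto simp: heights_def)
    with c(2)[of a] have "real a * c \<le> B" by linarith
    with c(1) have "real a \<le> B / c" by (simp add: field_simps)
    with a show "h \<in> level q ` {a. real a \<le> B / c}" by blast
  qed
  moreover have "{a. real a \<le> B / c} \<subseteq> {..nat \<lceil>B / c\<rceil>}"
    by (auto simp: le_nat_iff) linarith
  ultimately show ?thesis
    by (meson finite_atMost finite_imageI finite_subset)
qed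

lemma ex1_strict_mono_enum:
  fixes S :: "real set"
  assumes inf: "infinite S" and fin: "\<And>B. finite {s \<in> S. s \<le> B}"
  shows "\<exists>!h::nat \<Rightarrow> real. strict_mono h \<and> range h = S"
proof -
  define r where "r s = card {t \<in> S. t < s}" for s
  have finl: "finite {t \<in> S. t < s}" for s
    by (rule finite_subset[OF _ fin[of s]]) auto
  have r_less: "r s < r t" if "s \<in> S" "s < t" for s t
    unfolding r_def using that by (intro psubset_card_mono finl) auto
  then have r_iff: "r s < r t \<longleftrightarrow> s < t" if "s \<in> S" "t \<in> S" for s t
    using that by (metis linorder_neqE_linordered_idom not_less_iff_gr_or_eq)
  then have inj: "inj_on r S"
    by (intro inj_onI) (metis linorder_neqE_linordered_idom less_irrefl)
  have next_el: "\<exists>u\<in>S. P u \<and> (\<forall>t\<in>S. P t \<longrightarrow> u \<le> t)" if "t0 \<in> S" "P t0" for P t0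
  proof -
    let ?A = "{t \<in> S. P t \<and> t \<le> t0}"
    have "finite ?A" by (rule finite_subset[OF _ fin[of t0]]) auto
    moreover have "t0 \<in> ?A" using that by simp
    ultimately have "Min ?A \<in> ?A" "\<forall>t\<in>?A. Min ?A \<le> t"
      using Min_in by fastforce+
    then show ?thesis by (intro bexI[of _ "Min ?A"]) force+
  qed
  have surj: "\<exists>s\<in>S. r s = n" for n
  proof (induction n)
    case 0
    obtain t0 where "t0 \<in> S" using inf by (metis finite.emptyI ex_in_conv)
    from next_el[OF this, of "\<lambda>_. True"] obtain u where u: "u \<in> S" "\<forall>t\<in>S. u \<le> t" by auto
    then have "{t \<in> S. t < u} = {}" by force
    then have "r u = 0" unfolding r_def by (simp only: card.empty)
    with u show ?case by blast
  next
    case (Suc n)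
    then obtain s where s: "s \<in> S" "r s = n" by blast
    have "\<exists>t0\<in>S. s < t0"
    proof (rule ccontr)
      assume "\<not> ?thesis"
      then have "S = {t \<in> S. t \<le> s}" by force
      with fin[of s] inf show False by simp
    qed
    then obtain u where u: "u \<in> S" "s < u" "\<forall>t\<in>S. s < t \<longrightarrow> u \<le> t"
      using next_el[of _ "\<lambda>t. s < t"] by blast
    then have "{t \<in> S. t < u} = insert s {t \<in> S. t < s}" using s by force
    then have "r u = Suc n" using s finl[of s] by (simp add: r_def)
    with u show ?case by blast
  qed
  show ?thesis
  proof (rule ex_ex1I)
    define h where "h n = the_inv_into S r n" for n
    have "r ` S = UNIV"
      using surj by (metis UNIV_eq_I imageI)
    with inj have bij: "bij_betw r S UNIV"
      by (simp add: bij_betw_def)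
    have hS: "h n \<in> S" and rh: "r (h n) = n" for n
      using bij_betw_the_inv_into[OF bij] f_the_inv_into_f_bij_betw[OF bij]
      by (auto simp: h_def bij_betw_def)
    have "strict_mono h"
      by (rule strict_monoI) (metis hS rh r_iff)
    moreover have "range h = S"
      using bij_betw_the_inv_into[OF bij] by (simp add: h_def[abs_def] bij_betw_def)
    ultimately show "\<exists>h::nat \<Rightarrow> real. strict_mono h \<and> range h = S" by blast
  next
    have rank: "r (h n) = n" if "strict_mono h \<and> range h = S" for h :: "nat \<Rightarrow> real" and n
    proof -
      have "{t \<in> S. t < h n} = h ` {..<n}"
        using that by (auto simp: strict_mono_less)
      moreover have "inj_on h {..<n}"
        using that strict_mono_on_imp_inj_on by (metis inj_on_subset subset_UNIV)
      ultimately show ?thesis by (simp add: r_def card_image)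
    qed
    fix h h' :: "nat \<Rightarrow> real"
    assume *: "strict_mono h \<and> range h = S" "strict_mono h' \<and> range h' = S"
    show "h = h'"
    proof
      fix n
      have "h n \<in> S" "h' n \<in> S" using * by auto
      with inj rank[OF *(1), of n] rank[OF *(2), of n] show "h n = h' n"
        by (metis inj_onD)
    qed
  qed
qed

lemma height_enum:
  assumes "isotropic_params p q" "isotropic_params p' q'"
  shows "strict_mono (height_enum q q')"
    and "range (height_enum q q') = heights q \<union> heights q'"
proof -
  have "infinite (heights q)"
    unfolding heights_def
    using strict_mono_level[OF assms(1)] by (meson range_inj_infinite strict_mono_imp_inj_on)
  then have "infinite (heights q \<union> heights q')" by simp
  moreover have "finite {s \<in> heights q \<union> heights q'. s \<le> B}" for B
  proof -
    have "{s \<in> heights q \<union> heights q'. s \<le> B} =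
        {s \<in> heights q. s \<le> B} \<union> {s \<in> heights q'. s \<le> B}" by blast
    then show ?thesis using finite_heights_le[OF assms(1)] finite_heights_le[OF assms(2)] by simp
  qed
  ultimately have "\<exists>!h::nat \<Rightarrow> real. strict_mono h \<and> range h = heights q \<union> heights q'"
    by (rule ex1_strict_mono_enum)
  from theI'[OF this] show "strict_mono (height_enum q q')"
    and "range (height_enum q q') = heights q \<union> heights q'"
    unfolding height_enum_def by blast+
qed

end

theory Submission
  imports Defs
begin

text \<open>An embedding with constant \<open>C\<close> preserves heights and branch heights up to a constant \<open>D\<close>.
  Walking up the levels of both trees, one keeps a set \<open>S\<close> of vertices of the source whose images lie
  below one common vertex of the target: a branching of the source multiplies \<open>S\<close>, a branching of the
  target costs a pigeonhole step. Because of the error \<open>D\<close> the pigeonhole steps have to lag \<open>K\<close> levels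
  behind. For a constant target valence \<open>P\<close> all delayed divisions are alike, and
  \<open>\<lceil>P * m / P\<rceil> = m\<close> shows that the delay costs at most a factor \<open>P ^ K\<close>. Hence \<open>S\<close> has at least
  $\mathcal{X}_n / P^K$ elements; but \<open>S\<close> consists of vertices of equal depth with coarsely equal
  images, so its size is bounded.\<close>

section \<open>Uniform growth of the levels\<close>

lemma level_nonneg: "isotropic_params p q \<Longrightarrow> 0 \<le> level q a"
  using strict_mono_less_eq[OF strict_mono_level, of p q 0 a] by simp

text \<open>Edge lengths are at least \<open>ln ?m > 0\<close>, so one \<open>K\<close> serves all
  depths \<open>c\<close>. Both the lag \<open>K\<close> and the depth loss \<open>L\<close> of the
  final count come from here.\<close>

lemma level_window:
  assumes "isotropic_params p q"
  obtains K where "\<And>c. level q c + D \<le> level q (c + K)"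
proof -
  let ?m = "INF n\<in>{1..}. q n"
  have m: "?m > 1" using assms by (simp add: isotropic_params_def)
  have "bdd_below (q ` {1..})"
    using assms by (simp add: isotropic_params_def bounded_imp_bdd_below)
  then have le: "?m \<le> q (Suc a)" for a
    by (auto intro: cINF_lower)
  have step: "ln ?m \<le> ln (q (Suc a))" for a
    using le[of a] m by simp
  have "level q c + real k * ln ?m \<le> level q (c + k)" for c k
  proof (induction k)
    case (Suc k)
    then show ?case using step[of "c + k"] by (simp add: level_Suc algebra_simps)
  qed simp
  moreover obtain K where "D < real K * ln ?m"
    using m ex_less_of_nat_mult[of "ln ?m" D] by auto
  ultimately show ?thesis
    using that by (meson add_left_mono less_imp_le order_trans)
qed

text \<open>Edge lengths are at most \<open>ln B\<close>, so undoing a lag of \<open>K\<close>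
  levels costs a bounded height; truncation of \<open>b - K\<close> only shortens the way.\<close>

lemma level_diff_bounded:
  assumes "isotropic_params p q"
  obtains E where "\<And>b. level q b \<le> level q (b - K) + E"
proof -
  have "bdd_above (q ` {1..})"
    using assms by (simp add: isotropic_params_def bounded_imp_bdd_above)
  then obtain B where B: "q (Suc a) \<le> B" for a
    by (auto simp: bdd_above_def)
  have q1: "q (Suc a) > 1" for a
    using assms by (simp add: isotropic_params_def)
  have step: "ln (q (Suc a)) \<le> ln B" for a
    using B[of a] less_trans[OF zero_less_one q1[of a]] by (intro ln_mono) auto
  have lnB: "0 \<le> ln B"
    using B[of 0] q1[of 0] by simp
  have grow: "level q (c + k) \<le> level q c + real k * ln B" for c k
  proof (induction k)
    case (Suc k)
    then show ?case using step[of "c + k"] by (simp add: level_Suc algebra_simps)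
  qed simp
  have "level q b \<le> level q (b - K) + real K * ln B" for b
  proof -
    have "level q b \<le> level q (b - K) + real (b - (b - K)) * ln B"
      using grow[of "b - K" "b - (b - K)"] by simp
    also have "real (b - (b - K)) * ln B \<le> real K * ln B"
      using lnB by (intro mult_right_mono) auto
    finally show ?thesis by simp
  qed
  then show ?thesis using that by blast
qed

section \<open>Vertices as words and their common prefixes\<close>

lemma le_length_lcp_iff:
  "k \<le> length (longest_common_prefix u v) \<longleftrightarrow>
     k \<le> length u \<and> k \<le> length v \<and> take k u = take k v"
proof (induction u v arbitrary: k rule: longest_common_prefix.induct)
  case (1 x xs y ys)
  then show ?case by (cases k) auto
qed auto

lemma lcp_same [simp]: "longest_common_prefix w w = w"
  by (induction w) auto

text \<open>The vertices of the tree; equally the first components of its points, where a non-empty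
  word names an edge.\<close>

definition words :: "(nat \<Rightarrow> nat) \<Rightarrow> nat list set" where
  "words p = {w. \<forall>i<length w. w ! i < p (Suc i)}"

lemma words_snoc: "w \<in> words p \<Longrightarrow> j < p (Suc (length w)) \<Longrightarrow> w @ [j] \<in> words p"
  by (auto simp: words_def nth_append less_Suc_eq)

text \<open>Such words differ only in their last \<open>a - (a - L)\<close> letters, at most
  \<open>L\<close> many, each below \<open>Q\<close>.\<close>

lemma card_agreeing_words_le:
  assumes S: "S \<subseteq> words p" "\<forall>w\<in>S. length w = a"
    and agree: "\<forall>w\<in>S. \<forall>w'\<in>S. take (a - L) w = take (a - L) w'"
    and Q: "\<And>n. p (Suc n) \<le> Q" "Q > 0"
  shows "card S \<le> Q ^ L"
proof -
  let ?T = "{xs. set xs \<subseteq> {..<Q} \<and> length xs = a - (a - L)}"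
  have inj: "inj_on (drop (a - L)) S"
    using agree by (intro inj_onI) (metis append_take_drop_id)
  have sub: "drop (a - L) ` S \<subseteq> ?T"
  proof safe
    fix w x assume w: "w \<in> S" and x: "x \<in> set (drop (a - L) w)"
    then obtain i where "i < length w" "w ! i = x"
      by (meson in_set_dropD in_set_conv_nth)
    with w S Q(1)[of i] show "x < Q" by (fastforce simp: words_def)
  qed (use S in auto)
  have fin: "finite ?T" by (rule finite_lists_length_eq) simp
  have "card S \<le> card ?T" by (rule card_inj_on_le[OF inj sub fin])
  also have "\<dots> = Q ^ (a - (a - L))" by (simp add: card_lists_length_eq)
  also have "\<dots> \<le> Q ^ L" using Q(2) by (intro power_increasing) auto
  finally show "card S \<le> Q ^ L" .
qed

lemma finite_words: "finite {w \<in> words p. length w = a}"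
proof -
  have "{w \<in> words p. length w = a} \<subseteq> {xs. set xs \<subseteq> {..<Max (p ` {..a}) + 1} \<and> length xs = a}"
  proof safe
    fix w x assume w: "w \<in> words p" "x \<in> set w" "a = length w"
    then obtain i where "i < length w" "w ! i = x" by (meson in_set_conv_nth)
    with w have "x < p (Suc i)" "p (Suc i) \<le> Max (p ` {..length w})"
      by (auto simp: words_def)
    then show "x < Max (p ` {..length w}) + 1" by simp
  qed
  then show ?thesis by (rule finite_subset) (simp add: finite_lists_length_eq)
qed

section \<open>Crowded sets and their growth along the levels\<close>

text \<open>A rough isometric embedding enters only through the words \<open>F w\<close> of the edges that contain
  the images of the vertices \<open>w\<close>. The number \<open>K\<close> bounds how many levels of the target lie in a
  height window of length \<open>D\<close>.\<close>

locale rough_word_map =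
  fixes p p' :: "nat \<Rightarrow> nat" and q q' :: "nat \<Rightarrow> real" and F :: "nat list \<Rightarrow> nat list"
    and P K :: nat and D :: real
  assumes params: "isotropic_params p q" and params': "isotropic_params p' q'"
    and p'_const: "\<And>n. p' (Suc n) = P"
    and F_words: "\<And>w. w \<in> words p \<Longrightarrow> F w \<in> words p'"
    and F_lcp_ge: "\<And>w v. w \<in> words p \<Longrightarrow> v \<in> words p \<Longrightarrow>
      level q (length (longest_common_prefix w v))
        \<le> level q' (length (longest_common_prefix (F w) (F v))) + D"
    and F_lcp_le: "\<And>w v. w \<in> words p \<Longrightarrow> v \<in> words p \<Longrightarrow>
      min (min (level q (length w)) (level q (length v)))
          (level q' (length (longest_common_prefix (F w) (F v))))
        \<le> level q (length (longest_common_prefix w v)) + D"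
    and window: "\<And>c. level q' c + D \<le> level q' (c + K)"
begin

lemma P_pos: "P > 0"
  using params' p'_const[of 0] by (auto simp: isotropic_params_def dest: spec[of _ 1])

text \<open>While \<open>b < K\<close> no pigeonhole step has been made (\<open>b - K\<close> is truncated), and the factor
  \<open>P ^ (K - b)\<close> accounts for the first \<open>K\<close> divisions.\<close>

definition crowded :: "nat \<Rightarrow> nat \<Rightarrow> int \<Rightarrow> bool" where
  "crowded a b m \<longleftrightarrow> (\<exists>S y. S \<subseteq> words p \<and> (\<forall>w\<in>S. length w = a \<and> take (b - K) (F w) = y) \<and>
      m \<le> int (P ^ (K - b) * card S))"

text \<open>A depth \<open>c\<close> below \<open>b - K\<close> would leave level
  \<open>c + K\<close> strictly under \<open>level q a\<close>, against \<open>window\<close>. This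
  turns the height error \<open>D\<close> into the lag \<open>K\<close>.\<close>

lemma level_gap:
  assumes "level q a \<le> level q' c + D" "\<forall>i<b. level q' i < level q a"
  shows "b - K \<le> c"
proof (rule ccontr)
  assume "\<not> b - K \<le> c"
  then have "level q' (c + K) < level q a" using assms(2) by simp
  with window[of c] assms(1) show False by linarith
qed

text \<open>\<open>F_lcp_ge\<close> bounds the height of the common part of the images, and
  \<open>level_gap\<close> its depth. The length claim ensures that \<open>take (b - K)\<close>
  really yields \<open>b - K\<close> letters.\<close>

lemma F_take_eq:
  assumes "w \<in> words p" "v \<in> words p" "a \<le> length (longest_common_prefix w v)"
    and "\<forall>i<b. level q' i < level q a"
  shows "b - K \<le> length (F w)" "take (b - K) (F w) = take (b - K) (F v)"
proof -
  have "level q a \<le> level q (length (longest_common_prefix w v))"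
    using assms(3) strict_mono_level[OF params] by (simp add: strict_mono_less_eq)
  with F_lcp_ge[OF assms(1,2)]
  have "b - K \<le> length (longest_common_prefix (F w) (F v))"
    using assms(4) by (intro level_gap[of a]) linarith+
  then show "b - K \<le> length (F w)" "take (b - K) (F w) = take (b - K) (F v)"
    by (simp_all add: le_length_lcp_iff)
qed

text \<open>All children of the vertices in \<open>S\<close> are taken. Each child shares
  \<open>a\<close> letters with its parent, so its image keeps the prefix \<open>y\<close>.\<close>

lemma crowded_extend:
  assumes "crowded a b m" and below: "\<forall>i<b. level q' i < level q a"
  shows "crowded (Suc a) b (int (p (Suc a)) * m)"
proof -
  obtain S y where S: "S \<subseteq> words p" "\<forall>w\<in>S. length w = a \<and> take (b - K) (F w) = y"
    and m: "m \<le> int (P ^ (K - b) * card S)"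
    using assms(1) by (auto simp: crowded_def)
  let ?g = "\<lambda>(w, j). w @ [j::nat]"
  let ?S' = "?g ` (S \<times> {..<p (Suc a)})"
  have "inj_on ?g (S \<times> {..<p (Suc a)})"
    by (auto intro!: inj_onI)
  then have card: "card ?S' = card S * p (Suc a)"
    by (simp add: card_image card_cartesian_product)
  have "w @ [j] \<in> words p \<and> length (w @ [j]) = Suc a \<and> take (b - K) (F (w @ [j])) = y"
    if "w \<in> S" "j < p (Suc a)" for w j
  proof -
    have w: "w \<in> words p" "length w = a" "take (b - K) (F w) = y" using S that by auto
    have wj: "w @ [j] \<in> words p" using words_snoc w that by simp
    have "a \<le> length (longest_common_prefix (w @ [j]) w)"
      using w by (simp add: le_length_lcp_iff)
    from F_take_eq(2)[OF wj w(1) this below] w wj show ?thesis by simp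
  qed
  then have "?S' \<subseteq> words p" "\<forall>w\<in>?S'. length w = Suc a \<and> take (b - K) (F w) = y"
    by auto
  moreover have "int (p (Suc a)) * m \<le> int (P ^ (K - b) * card ?S')"
    using mult_left_mono[OF m, of "int (p (Suc a))"] unfolding card by (simp add: mult_ac)
  ultimately show ?thesis unfolding crowded_def by blast
qed

text \<open>In the first \<open>K\<close> steps the division is paid for by lowering the exponent in
  \<open>P ^ (K - b)\<close>; afterwards \<open>S\<close> is split by the next image letter and a
  class of at least average size is kept.\<close>

lemma crowded_pigeonhole:
  assumes "crowded a b m" and below: "\<forall>i<Suc b. level q' i < level q a"
  shows "crowded a (Suc b) \<lceil>real_of_int m / real P\<rceil>"
proof -
  obtain S y where S: "S \<subseteq> words p" "\<forall>w\<in>S. length w = a \<and> take (b - K) (F w) = y"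
    and m: "m \<le> int (P ^ (K - b) * card S)"
    using assms(1) by (auto simp: crowded_def)
  \<comment> \<open>The bound \<open>k\<close> is an integer and \<open>P * k / P\<close> is exactly
    \<open>k\<close>, so rounding up loses nothing.\<close>
  have ceil: "\<lceil>real_of_int m / real P\<rceil> \<le> int k" if "m \<le> int (P * k)" for k
  proof -
    have "real_of_int m \<le> real_of_int (int (P * k))" using that by (simp only: of_int_le_iff)
    then have "real_of_int m / real P \<le> real k"
      using P_pos by (simp add: field_simps)
    then show ?thesis by (simp add: ceiling_le_iff)
  qed
  show ?thesis
  proof (cases "b < K")
    case True
    then have "K - b = Suc (K - Suc b)" by simp
    then have "\<lceil>real_of_int m / real P\<rceil> \<le> int (P ^ (K - Suc b) * card S)"
      using m by (intro ceil) (simp add: mult_ac)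
    with S True show ?thesis unfolding crowded_def by (intro exI[of _ S] exI[of _ y]) auto
  next
    case False
    let ?k = "b - K"
    have k: "Suc b - K = Suc ?k" using False by simp
    \<comment> \<open>Level \<open>b\<close> also lies strictly below \<open>level q a\<close>, so
      the image words do have a letter at position \<open>b - K\<close>.\<close>
    have len: "Suc ?k \<le> length (F w)" if "w \<in> S" for w
      using F_take_eq(1)[of w w a "Suc b"] S that below k by auto
    have fin: "finite S"
      by (rule finite_subset[OF _ finite_words[of p a]]) (use S in auto)
    let ?T = "\<lambda>j. {w \<in> S. F w ! ?k = j}"
    have "F w ! ?k < P" if "w \<in> S" for w
      using F_words[of w] len[OF that] S that p'_const by (auto simp: words_def)
    then have "S = (\<Union>j<P. ?T j)" by auto
    then have le: "card S \<le> (\<Sum>j<P. card (?T j))"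
      using card_UN_le[of "{..<P}" ?T] by simp
    have "\<exists>j. card S \<le> P * card (?T j)"
    proof (rule ccontr)
      assume "\<not> ?thesis"
      then have "P * card (?T j) < card S" for j by (simp add: not_le)
      then have "(\<Sum>j<P. P * card (?T j)) < (\<Sum>j<P. card S)"
        using P_pos by (intro sum_strict_mono) auto
      with le show False by (simp add: sum_distrib_left[symmetric])
    qed
    then obtain j where j: "card S \<le> P * card (?T j)" by blast
    have "\<lceil>real_of_int m / real P\<rceil> \<le> int (card (?T j))"
    proof (rule ceil)
      have "m \<le> int (card S)" using m False by simp
      also have "\<dots> \<le> int (P * card (?T j))" using j by (simp only: of_nat_le_iff)
      finally show "m \<le> int (P * card (?T j))" .
    qed
    moreover have "take (Suc ?k) (F w) = y @ [j]" if "w \<in> ?T j" for w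
      using that S len[of w] by (auto simp: take_Suc_conv_app_nth)
    ultimately show ?thesis
      unfolding crowded_def k using S False
      by (intro exI[of _ "?T j"] exI[of _ "y @ [j]"]) auto
  qed
qed

text \<open>Induction with \<open>a\<close> and \<open>b\<close> counting the levels of each tree
  strictly below the current height. Passing to the next height adds the levels at the old one, and
  each rule of the recursion matches one or both of the crowding steps.\<close>

lemma crowded_comparison_seq:
  "\<exists>a b. (\<forall>i. level q i < height_enum q q' n \<longleftrightarrow> i < a) \<and>
     (\<forall>i. level q' i < height_enum q q' n \<longleftrightarrow> i < b) \<and>
     crowded a b (comparison_seq p q p' q' n)"
proof (induction n)
  case 0
  note enum = height_enum[OF params params']
  have "level q 0 \<in> heights q \<union> heights q'" unfolding heights_def by (intro UnI1 rangeI)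
  then obtain k where "level q 0 = height_enum q q' k" unfolding enum(2)[symmetric] by (rule rangeE)
  then have "height_enum q q' k = 0" by simp
  moreover have "height_enum q q' 0 \<le> height_enum q q' k"
    using enum(1) by (simp add: strict_mono_less_eq)
  ultimately have le: "height_enum q q' 0 \<le> 0" by simp
  \<comment> \<open>No level is negative, so both counts start at 0, and the root alone is the
    crowd.\<close>
  have "\<not> level q i < height_enum q q' 0" "\<not> level q' i < height_enum q q' 0" for i
    using le level_nonneg[OF params, of i] level_nonneg[OF params', of i] by simp_all
  moreover have "1 \<le> int (P ^ K)" using P_pos by (simp add: Suc_le_eq)
  then have "crowded 0 0 1"
    unfolding crowded_def by (intro exI[of _ "{[]}"] exI[of _ "[]"]) (simp add: words_def)
  ultimately show ?case by (intro exI[of _ 0]) simp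
next
  case (Suc n)
  note enum = height_enum[OF params params']
  let ?h = "height_enum q q'"
  let ?x = "comparison_seq p q p' q' n"
  from Suc obtain a b where "(\<forall>i. level q i < ?h n \<longleftrightarrow> i < a) \<and>
      (\<forall>i. level q' i < ?h n \<longleftrightarrow> i < b) \<and> crowded a b ?x"
    by (elim exE)
  then have a: "level q i < ?h n \<longleftrightarrow> i < a" and b: "level q' i < ?h n \<longleftrightarrow> i < b"
    and crowd: "crowded a b ?x" for i
    by simp_all
  \<comment> \<open>No level of either tree lies strictly between consecutive enumerated
    heights.\<close>
  have less_Suc: "t < ?h (Suc n) \<longleftrightarrow> t < ?h n \<or> t = ?h n" if "t \<in> heights q \<union> heights q'" for t
  proof -
    have "t \<in> range ?h" using that unfolding enum(2) .
    then obtain k where "t = ?h k" by blast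
    then show ?thesis
      by (simp add: strict_mono_less[OF enum(1)] strict_mono_eq[OF enum(1)] less_Suc_eq)
  qed
  have lev: "level q i \<in> heights q \<union> heights q'" "level q' i \<in> heights q \<union> heights q'" for i
    by (auto simp: heights_def)
  note mono = strict_mono_level[OF params] and mono' = strict_mono_level[OF params']
  \<comment> \<open>A level at the current height has as index the number of levels strictly below
    it.\<close>
  have at: "?h n = level q a" "depth_of q (?h n) = a" if h: "?h n \<in> heights q"
  proof -
    obtain c where c: "?h n = level q c" using h unfolding heights_def by blast
    then have "i < c \<longleftrightarrow> i < a" for i using a[of i] mono by (simp add: strict_mono_less)
    then have "c = a" by (metis nat_neq_iff)
    with c show "?h n = level q a" "depth_of q (?h n) = a"
      by (simp_all add: depth_of_level[OF params])
  qed
  have at': "?h n = level q' b" "depth_of q' (?h n) = b" if h: "?h n \<in> heights q'"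
  proof -
    obtain c where c: "?h n = level q' c" using h unfolding heights_def by blast
    then have "i < c \<longleftrightarrow> i < b" for i using b[of i] mono' by (simp add: strict_mono_less)
    then have "c = b" by (metis nat_neq_iff)
    with c show "?h n = level q' b" "depth_of q' (?h n) = b"
      by (simp_all add: depth_of_level[OF params'])
  qed
  have a_Suc: "level q i < ?h (Suc n) \<longleftrightarrow> i < (if ?h n \<in> heights q then Suc a else a)" for i
  proof (cases "?h n \<in> heights q")
    case True
    then have "level q i = ?h n \<longleftrightarrow> i = a"
      using at(1) mono by (metis strict_mono_eq)
    with True show ?thesis
      using less_Suc[OF lev(1), of i] a[of i] by (simp add: less_Suc_eq)
  next
    case False
    then have "level q i \<noteq> ?h n" by (metis heights_def rangeI)
    with False show ?thesis
      using less_Suc[OF lev(1), of i] a[of i] by simp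
  qed
  have b_Suc: "level q' i < ?h (Suc n) \<longleftrightarrow> i < (if ?h n \<in> heights q' then Suc b else b)" for i
  proof (cases "?h n \<in> heights q'")
    case True
    then have "level q' i = ?h n \<longleftrightarrow> i = b"
      using at'(1) mono' by (metis strict_mono_eq)
    with True show ?thesis
      using less_Suc[OF lev(2), of i] b[of i] by (simp add: less_Suc_eq)
  next
    case False
    then have "level q' i \<noteq> ?h n" by (metis heights_def rangeI)
    with False show ?thesis
      using less_Suc[OF lev(2), of i] b[of i] by simp
  qed
  have "?h n \<in> heights q \<union> heights q'" using enum(2) by blast
  then consider "?h n \<in> heights q" "?h n \<notin> heights q'" | "?h n \<notin> heights q" "?h n \<in> heights q'"
    | "?h n \<in> heights q" "?h n \<in> heights q'" by blast
  then have "crowded (if ?h n \<in> heights q then Suc a else a)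
      (if ?h n \<in> heights q' then Suc b else b) (comparison_seq p q p' q' (Suc n))"
  proof cases
    case 1
    have "\<forall>i<b. level q' i < level q a" using b at(1)[OF 1(1)] by simp
    from crowded_extend[OF crowd this] 1 at(2) show ?thesis
      by (simp add: Let_def)
  next
    case 2
    \<comment> \<open>As \<open>?h n\<close> is no source level, \<open>level q a\<close> lies
      strictly above it, hence above \<open>level q' b\<close>, as the pigeonhole step
      demands.\<close>
    have "level q a \<noteq> ?h n" using 2 by (metis heights_def rangeI)
    with a[of a] have ha: "?h n < level q a" by simp
    have "level q' i < level q a" if "i < Suc b" for i
      using that b[of i] at'(1)[OF 2(2)] ha by (cases "i = b") auto
    with crowded_pigeonhole[OF crowd] 2 at'(2) show ?thesis
      by (simp add: Let_def p'_const)
  next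
    case 3
    \<comment> \<open>At a shared height the source branches first: \<open>level q' b\<close> equals
      \<open>level q a\<close> and is strictly below only \<open>level q (Suc a)\<close>.\<close>
    have below: "\<forall>i<b. level q' i < level q a" using b at(1)[OF 3(1)] by simp
    have "level q a < level q (Suc a)" using mono by (simp add: strict_mono_less)
    then have "level q' i < level q (Suc a)" if "i < Suc b" for i
      using that b[of i] at(1)[OF 3(1)] at'(1)[OF 3(2)] by (cases "i = b") auto
    with crowded_pigeonhole[OF crowded_extend[OF crowd below]] 3 at(2) at'(2) show ?thesis
      by (simp add: Let_def p'_const)
  qed
  with a_Suc b_Suc show ?case by (intro exI conjI allI)
qed

section \<open>The bound on the comparison sequence\<close>

text \<open>Images sharing \<open>b - K\<close> letters agree up to a bounded distance from the
  current height. By \<open>F_lcp_le\<close> so do the words of \<open>S\<close>; they share all but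
  their last \<open>L\<close> letters, so there are at most \<open>Q ^ L\<close> of them.\<close>

lemma comparison_seq_bounded_above:
  obtains M where "\<And>n. comparison_seq p q p' q' n \<le> int M"
proof -
  obtain E where E: "\<And>b. level q' b \<le> level q' (b - K) + E"
    by (rule level_diff_bounded[OF params', of K]) blast
  \<comment> \<open>\<open>L\<close> source levels make up for two losses: \<open>E\<close> from the
    lag and \<open>D\<close> from \<open>F\<close>.\<close>
  obtain L where L: "\<And>c. level q c + (max 0 E + D) \<le> level q (c + L)"
    by (rule level_window[OF params, of "max 0 E + D"]) blast
  have "bdd_above (p ` {1..})" using params by (simp add: isotropic_params_def)
  then obtain Q where Q: "\<And>n. p (Suc n) \<le> Q" by (auto simp: bdd_above_def)
  have "p 1 \<ge> 2" using params by (simp add: isotropic_params_def)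
  with Q[of 0] have "Q > 0" by simp
  have "comparison_seq p q p' q' n \<le> int (P ^ K * Q ^ L)" for n
  proof -
    let ?h = "height_enum q q' n"
    from crowded_comparison_seq[of n] obtain a b
      where "(\<forall>i. level q i < ?h \<longleftrightarrow> i < a) \<and> (\<forall>i. level q' i < ?h \<longleftrightarrow> i < b) \<and>
        crowded a b (comparison_seq p q p' q' n)"
      by (elim exE)
    then have a: "level q i < ?h \<longleftrightarrow> i < a" and b: "level q' i < ?h \<longleftrightarrow> i < b"
      and "crowded a b (comparison_seq p q p' q' n)" for i
      by simp_all
    then obtain S y where S: "S \<subseteq> words p" "\<forall>w\<in>S. length w = a \<and> take (b - K) (F w) = y"
      and m: "comparison_seq p q p' q' n \<le> int (P ^ (K - b) * card S)"
      by (auto simp: crowded_def)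
    have ha: "?h \<le> level q a" and hb: "?h \<le> level q' b" using a[of a] b[of b] by auto
    have "a - L \<le> length (longest_common_prefix w v)" if wv: "w \<in> S" "v \<in> S" for w v
    proof (rule ccontr)
      let ?c = "length (longest_common_prefix w v)"
      \<comment> \<open>Then \<open>?c + L < a\<close>, so the two words would separate more than
        \<open>max 0 E + D\<close> before height \<open>?h\<close>.\<close>
      assume "\<not> a - L \<le> ?c"
      then have lt: "level q (?c + L) < ?h" using a by simp
      have len: "length w = a" "length v = a" and w: "w \<in> words p" "v \<in> words p"
        using S wv by auto
      have below: "\<forall>i<b. level q' i < level q a" using b order_less_le_trans[OF _ ha] by simp
      have "b - K \<le> length (F w)" "b - K \<le> length (F v)"
        using F_take_eq(1)[OF w(1) w(1) _ below] F_take_eq(1)[OF w(2) w(2) _ below] len by simp_all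
      moreover have "take (b - K) (F w) = take (b - K) (F v)" using S wv by simp
      ultimately have "b - K \<le> length (longest_common_prefix (F w) (F v))"
        by (simp add: le_length_lcp_iff)
      then have "level q' (b - K) \<le> level q' (length (longest_common_prefix (F w) (F v)))"
        using strict_mono_level[OF params'] by (simp add: strict_mono_less_eq)
      with hb E[of b] have "?h - max 0 E \<le> level q' (length (longest_common_prefix (F w) (F v)))"
        by linarith
      moreover have "?h - max 0 E \<le> level q a" using ha by linarith
      ultimately have "?h - max 0 E \<le> level q ?c + D"
        using F_lcp_le[OF w] unfolding len min.idem min_le_iff_disj by linarith
      with L[of ?c] lt show False by linarith
    qed
    then have agree: "\<forall>w\<in>S. \<forall>v\<in>S. take (a - L) w = take (a - L) v"
      unfolding le_length_lcp_iff by blast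
    have "\<forall>w\<in>S. length w = a" using S(2) by blast
    from card_agreeing_words_le[OF S(1) this agree Q \<open>Q > 0\<close>] have "card S \<le> Q ^ L" .
    moreover have "P ^ (K - b) \<le> P ^ K" using P_pos by (intro power_increasing) auto
    ultimately have "P ^ (K - b) * card S \<le> P ^ K * Q ^ L" by (intro mult_mono) auto
    then have "int (P ^ (K - b) * card S) \<le> int (P ^ K * Q ^ L)" by (simp only: of_nat_le_iff)
    with m show ?thesis by (rule order_trans)
  qed
  then show ?thesis using that by blast
qed

end

section \<open>Nonnegativity, and the passage from embeddings to words\<close>

lemma comparison_seq_nonneg: "0 \<le> comparison_seq p q p' q' n"
proof (induction n)
  case (Suc n)
  then have "0 \<le> real_of_int (comparison_seq p q p' q' n)" by simp
  \<comment> \<open>A ceiling is nonnegative once its argument exceeds -1; for \<open>k = 0\<close>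
    the quotient is 0.\<close>
  then have "- 1 < real_of_int (comparison_seq p q p' q' n) / real k"
    "- 1 < real j * real_of_int (comparison_seq p q p' q' n) / real k" for j k
    by (auto intro: less_le_trans[of _ 0])
  with Suc show ?case by (simp add: Let_def zero_le_ceiling)
qed simp

text \<open>A vertex sits at the far end of its last edge; the root ends no edge and is the point
  \<open>([], 0)\<close>.\<close>

definition vertex :: "(nat \<Rightarrow> real) \<Rightarrow> nat list \<Rightarrow> nat list \<times> real" where
  "vertex q w = (w, if w = [] then 0 else ln (q (length w)))"

lemma vertex_in_tree:
  assumes "isotropic_params p q" "w \<in> words p"
  shows "vertex q w \<in> isotropic_tree p q"
proof (cases "w = []")
  case False
  then have "q (length w) > 1"
    using assms(1) by (simp add: isotropic_params_def Suc_le_eq)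
  with False assms(2) show ?thesis
    by (auto simp: vertex_def isotropic_tree_def words_def)
qed (simp add: vertex_def isotropic_tree_def)

lemma height_vertex: "height q (vertex q w) = level q (length w)"
  by (cases w) (simp_all add: height_def vertex_def level_Suc)

lemma branch_height_vertex:
  assumes "isotropic_params p q"
  shows "branch_height q (vertex q w) (vertex q v) = level q (length (longest_common_prefix w v))"
proof -
  have "length (longest_common_prefix w v) \<le> length w" "length (longest_common_prefix w v) \<le> length v"
    using le_length_lcp_iff by blast+
  then have "level q (length (longest_common_prefix w v)) \<le> level q (length w)"
    "level q (length (longest_common_prefix w v)) \<le> level q (length v)"
    using strict_mono_level[OF assms] by (simp_all add: strict_mono_less_eq)
  then show ?thesis by (simp add: branch_height_def height_vertex) (simp add: vertex_def)
qed

lemma fst_tree_words: "x \<in> isotropic_tree p q \<Longrightarrow> fst x \<in> words p"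
  by (auto simp: isotropic_tree_def words_def)

lemma tree_dist_root:
  assumes "isotropic_params p q" "x \<in> isotropic_tree p q"
  shows "tree_dist q ([], 0) x = height q x"
proof -
  have "0 \<le> height q x"
    using assms(2) level_nonneg[OF assms(1)] by (auto simp: isotropic_tree_def height_def)
  then show ?thesis by (simp add: tree_dist_def branch_height_def height_def[of q "([], 0)"])
qed

text \<open>Heights are distances from the root, which \<open>f\<close> moves by a fixed amount
  \<open>e\<close> from the target root. The branch height is the Gromov product: half of the sum of
  the heights minus the distance.\<close>

lemma rough_isometric_embedding_coarse:
  assumes "isotropic_params p q" "isotropic_params p' q'"
    and "rough_isometric_embedding
      (isotropic_tree p q) (tree_dist q) (isotropic_tree p' q') (tree_dist q') f"
  obtains D where "D \<ge> 0"
    and "\<And>x. x \<in> isotropic_tree p q \<Longrightarrow> \<bar>height q' (f x) - height q x\<bar> \<le> D"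
    and "\<And>x y. x \<in> isotropic_tree p q \<Longrightarrow> y \<in> isotropic_tree p q \<Longrightarrow>
      \<bar>branch_height q' (f x) (f y) - branch_height q x y\<bar> \<le> D"
proof -
  let ?R = "isotropic_tree p q" and ?R' = "isotropic_tree p' q'"
  obtain C where C: "C \<ge> 0" "\<And>x y. x \<in> ?R \<Longrightarrow> y \<in> ?R \<Longrightarrow>
      \<bar>tree_dist q' (f x) (f y) - tree_dist q x y\<bar> \<le> C"
    and f: "\<And>x. x \<in> ?R \<Longrightarrow> f x \<in> ?R'"
    using assms(3) by (auto simp: rough_isometric_embedding_def)
  interpret M: Metric_space ?R' "tree_dist q'"
    by (rule Metric_space_isotropic_tree[OF assms(2)])
  let ?b = "([], 0)"
  have b: "?b \<in> ?R" "?b \<in> ?R'" by (auto simp: isotropic_tree_def)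
  define e where "e = tree_dist q' ?b (f ?b)"
  have e: "0 \<le> e" by (simp add: e_def)
  have h: "\<bar>height q' (f x) - height q x\<bar> \<le> C + e" if x: "x \<in> ?R" for x
    using C(2)[OF b(1) x] M.triangle[OF b(2) f[OF b(1)] f[OF x]]
      M.triangle[OF f[OF b(1)] b(2) f[OF x]] M.commute[of "f ?b" ?b]
      tree_dist_root[OF assms(1) x] tree_dist_root[OF assms(2) f[OF x]]
    unfolding e_def by linarith
  show ?thesis
  \<comment> \<open>Half of two height errors \<open>C + e\<close> plus one distance error
    \<open>C\<close> is \<open>3 * C / 2 + e\<close>, at most \<open>2 * (C + e)\<close>.\<close>
  proof (rule that[of "2 * (C + e)"])
    show "0 \<le> 2 * (C + e)" using C(1) e by simp
    show "\<bar>height q' (f x) - height q x\<bar> \<le> 2 * (C + e)" if "x \<in> ?R" for x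
      using order_trans[OF h[OF that], of "2 * (C + e)"] C(1) e by simp
    show "\<bar>branch_height q' (f x) (f y) - branch_height q x y\<bar> \<le> 2 * (C + e)"
      if "x \<in> ?R" "y \<in> ?R" for x y
      using h[OF that(1)] h[OF that(2)] C(2)[OF that, unfolded tree_dist_def] C(1) e
      unfolding abs_le_iff by (simp add: algebra_simps)
  qed
qed

theorem theorem5:
  fixes p p' :: "nat \<Rightarrow> nat" and q q' :: "nat \<Rightarrow> real"
  assumes "isotropic_params p q"
    and "isotropic_params p' q'"
    and "p' constant_on {1..}"
    and "\<not> bounded (range (\<lambda>n. real_of_int (comparison_seq p q p' q' n)))"
  shows "\<nexists>f. rough_isometric_embedding
           (isotropic_tree p q) (tree_dist q) (isotropic_tree p' q') (tree_dist q') f"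
proof
  assume "\<exists>f. rough_isometric_embedding
           (isotropic_tree p q) (tree_dist q) (isotropic_tree p' q') (tree_dist q') f"
  then obtain f where f: "rough_isometric_embedding
           (isotropic_tree p q) (tree_dist q) (isotropic_tree p' q') (tree_dist q') f" ..
  obtain D where D: "D \<ge> 0"
    and hD: "\<And>x. x \<in> isotropic_tree p q \<Longrightarrow> \<bar>height q' (f x) - height q x\<bar> \<le> D"
    and brD: "\<And>x y. x \<in> isotropic_tree p q \<Longrightarrow> y \<in> isotropic_tree p q \<Longrightarrow>
      \<bar>branch_height q' (f x) (f y) - branch_height q x y\<bar> \<le> D"
    by (rule rough_isometric_embedding_coarse[OF assms(1,2) f]) blast
  obtain K where K: "\<And>c. level q' c + 2 * D \<le> level q' (c + K)"
    using level_window[OF assms(2)] by blast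
  obtain P where P: "\<And>n. p' (Suc n) = P"
    using assms(3) by (auto simp: constant_on_def)
  \<comment> \<open>Only the edge containing the image is kept, not the position on it.\<close>
  define F where "F w = fst (f (vertex q w))" for w
  \<comment> \<open>One \<open>D\<close> compares branch heights; \<open>F_lcp_le\<close> takes a
    second one to replace the image heights by those of the source.\<close>
  interpret rough_word_map p p' q q' F P K "2 * D"
  proof
    fix w v assume w: "w \<in> words p" and v: "v \<in> words p"
    note wv = vertex_in_tree[OF assms(1) w] vertex_in_tree[OF assms(1) v]
    note * = hD[OF wv(1)] hD[OF wv(2)] brD[OF wv]
    show "level q (length (longest_common_prefix w v))
        \<le> level q' (length (longest_common_prefix (F w) (F v))) + 2 * D"
      using *(3) D unfolding branch_height_vertex[OF assms(1)] F_def branch_height_def[of q']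
      by linarith
    show "min (min (level q (length w)) (level q (length v)))
          (level q' (length (longest_common_prefix (F w) (F v))))
        \<le> level q (length (longest_common_prefix w v)) + 2 * D"
      using * D unfolding branch_height_vertex[OF assms(1)] height_vertex F_def
        branch_height_def[of q'] by linarith
  next
    fix w assume "w \<in> words p"
    then show "F w \<in> words p'"
      using vertex_in_tree[OF assms(1)] f fst_tree_words
      unfolding F_def rough_isometric_embedding_def by blast
  qed (use assms(1,2) P K in auto)
  obtain M where "\<And>n. comparison_seq p q p' q' n \<le> int M"
    using comparison_seq_bounded_above by blast
  then have "\<bar>real_of_int (comparison_seq p q p' q' n)\<bar> \<le> real M" for n
    using comparison_seq_nonneg[of p q p' q' n] by (metis abs_of_nonneg of_int_0_le_iff of_int_le_iff of_int_of_nat_eq)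
  then have "bounded (range (\<lambda>n. real_of_int (comparison_seq p q p' q' n)))"
    by (auto simp: bounded_iff)
  with assms(4) show False ..
qed

end
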